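(* Let $D_0(\mathbb{T}^2)$ be the set of torus homeomorphisms $T:\mathbb{T}^2\to\mathbb{T}^2$ of the form $T(x,y)=(x',y')$ with $$y'=g(x)+y \bmod 1,\qquad x'=x+y' \bmod 1,$$ where $g:S^1\to\mathbb{R}$ is a Lipschitz function with $\int_{S^1} g(x)\,dx=0$, endowed with the $C^0$ topology. Then the functions $$\rho_V^{\max},\ \rho_V^{\min}:D_0(\mathbb{T}^2)\to\mathbb{R}$$ are continuous.
   Context: $S^1=\mathbb{R}/\mathbb{Z}$ and $\mathbb{T}^2=\mathbb{R}^2/\mathbb{Z}^2$. The $C^0$ topology is the topology of uniform convergence of maps of $\mathbb{T}^2$. Given $T\in D_0(\mathbb{T}^2)$ with associated function $g$ (uniquely determined by $T$, because of the zero mean condition), its lift to the cylinder is $\widehat T:S^1\times\mathbb{R}\to S^1\times\mathbb{R}$, $\widehat T(x,y)=(x',y')$ with $y'=g(x)+y$ and $x'=x+y' \bmod 1$. Let $p_2(x,y)=y$ on $S^1\times\mathbb{R}$. The vertical rotation set $\rho_V(T)\subset\mathbb{R}$ is the set of all $\omega\in\mathbb{R}$ for which there is a point $X\in S^1\times\mathbb{R}$ with $$\lim_{n\to\infty}\frac{p_2\circ \widehat T^n(X)-p_2(X)}{n}=\omega .$$ It is a closed bounded interval, denoted $[\rho_V^{\min}(T),\rho_V^{\max}(T)]$; thus $\rho_V^{\min}(T)$ and $\rho_V^{\max}(T)$ are its minimum and maximum. *)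

theory Defs
  imports "HOL-Analysis.Analysis"
begin

section \<open>The circle \<open>\<real>/\<int>\<close>\<close>

definition cong1 :: "real \<Rightarrow> real \<Rightarrow> bool"
  where "cong1 x y \<longleftrightarrow> x - y \<in> \<int>"

lemma equivp_cong1: "equivp cong1"
proof (rule equivpI)
  show "reflp cong1" by (simp add: reflp_def cong1_def)
  show "symp cong1" unfolding symp_def cong1_def by (metis Ints_minus minus_diff_eq)
  show "transp cong1"
    unfolding transp_def cong1_def by (metis Ints_add diff_add_cancel add_diff_eq)
qed

quotient_type circle = real / cong1
  morphisms rep_circle to_circle
  by (rule equivp_cong1)

lemma to_circle_eq_iff: "to_circle x = to_circle y \<longleftrightarrow> x - y \<in> \<int>"
  by (simp add: circle.abs_eq_iff cong1_def)

instantiation circle :: ab_group_add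
begin

lift_definition zero_circle :: circle is 0 .

lift_definition plus_circle :: "circle \<Rightarrow> circle \<Rightarrow> circle" is "(+)"
  unfolding cong1_def by (metis Ints_add add_diff_add)

lift_definition uminus_circle :: "circle \<Rightarrow> circle" is uminus
  unfolding cong1_def by (metis Ints_minus minus_diff_minus)

lift_definition minus_circle :: "circle \<Rightarrow> circle \<Rightarrow> circle" is "(-)"
  unfolding cong1_def by (metis Ints_diff diff_diff_eq2 diff_add_eq add_diff_eq add.commute diff_diff_eq)

instance
  by (standard; transfer) (simp_all add: cong1_def)

end

lemma to_circle_add: "to_circle (x + y) = to_circle x + to_circle y"
  by (simp add: plus_circle.abs_eq)

text \<open>The quotient metric: the distance between two classes is the distance of \<open>x - y\<close> to a
  nearest integer.\<close>

lemma dist_nearest_int_le: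
  "\<bar>x - of_int (round x)\<bar> \<le> \<bar>x - z\<bar>" if "z \<in> \<int>" for x z :: real
  using that by (metis Ints_cases round_diff_minimal)

instantiation circle :: metric_space
begin

lift_definition dist_circle :: "circle \<Rightarrow> circle \<Rightarrow> real"
  is "\<lambda>x y. \<bar>(x - y) - of_int (round (x - y))\<bar>"
proof -
  have le: "\<bar>(a - b) - of_int (round (a - b))\<bar> \<le> \<bar>(c - d) - of_int (round (c - d))\<bar>"
    if "a - c \<in> \<int>" "b - d \<in> \<int>" for a b c d :: real
  proof -
    have "of_int (round (c - d)) + ((a - c) - (b - d)) \<in> \<int>"
      using that by (metis Ints_add Ints_diff Ints_of_int)
    from dist_nearest_int_le[OF this, of "a - b"] show ?thesis
      by (simp add: algebra_simps)
  qed
  fix x1 x2 y1 y2 :: real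
  assume "cong1 x1 x2" "cong1 y1 y2"
  then have "x1 - x2 \<in> \<int>" "y1 - y2 \<in> \<int>" "x2 - x1 \<in> \<int>" "y2 - y1 \<in> \<int>"
    unfolding cong1_def by (auto intro: Ints_minus[of "_ - _", simplified])
  then show "\<bar>(x1 - y1) - of_int (round (x1 - y1))\<bar> = \<bar>(x2 - y2) - of_int (round (x2 - y2))\<bar>"
    by (intro antisym le)
qed

definition uniformity_circle :: "(circle \<times> circle) filter"
  where "uniformity_circle = (INF e\<in>{0<..}. principal {(x, y). dist x y < e})"

definition open_circle :: "circle set \<Rightarrow> bool"
  where "open_circle S = (\<forall>x\<in>S. \<forall>\<^sub>F (x', y) in uniformity. x' = x \<longrightarrow> y \<in> S)"

instance
proof
  show "dist a b = 0 \<longleftrightarrow> a = b" for a b :: circle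
  proof transfer
    fix x y :: real
    have "\<bar>(x - y) - of_int (round (x - y))\<bar> = 0" if "x - y \<in> \<int>"
      using dist_nearest_int_le[OF that, of "x - y"] by simp
    moreover have "x - y \<in> \<int>" if "\<bar>(x - y) - of_int (round (x - y))\<bar> = 0"
    proof -
      from that have "x - y = of_int (round (x - y))" by linarith
      then show ?thesis by (metis Ints_of_int)
    qed
    ultimately show "\<bar>(x - y) - of_int (round (x - y))\<bar> = 0 \<longleftrightarrow> cong1 x y"
      unfolding cong1_def by blast
  qed
  show "dist a b \<le> dist a c + dist b c" for a b c :: circle
  proof transfer
    fix x y z :: real
    have "\<bar>(x - y) - of_int (round (x - y))\<bar>
        \<le> \<bar>(x - y) - (of_int (round (x - z)) - of_int (round (y - z)))\<bar>"
      by (rule dist_nearest_int_le) auto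
    also have "\<dots> \<le> \<bar>(x - z) - of_int (round (x - z))\<bar> + \<bar>(y - z) - of_int (round (y - z))\<bar>"
      by linarith
    finally show "\<bar>(x - y) - of_int (round (x - y))\<bar>
        \<le> \<bar>(x - z) - of_int (round (x - z))\<bar> + \<bar>(y - z) - of_int (round (y - z))\<bar>" .
  qed
qed (simp_all add: uniformity_circle_def open_circle_def)

end

lemma dist_to_circle_le: "dist (to_circle x) (to_circle y) \<le> \<bar>x - y\<bar>"
  using dist_nearest_int_le[of 0 "x - y"] by (simp add: dist_circle.abs_eq)

lemma continuous_on_to_circle: "continuous_on A to_circle"
  by (rule lipschitz_on_continuous_on[of 1])
     (auto simp: lipschitz_on_def dist_real_def dist_to_circle_le)

section \<open>The twist homeomorphisms and their vertical rotation sets\<close>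

type_synonym torus = "circle \<times> circle"

definition zero_mean_lipschitz :: "(circle \<Rightarrow> real) \<Rightarrow> bool"
  where "zero_mean_lipschitz g \<longleftrightarrow>
    (\<exists>L. L-lipschitz_on UNIV g) \<and> integral {0..1} (\<lambda>t. g (to_circle t)) = 0"

definition twist_map :: "(circle \<Rightarrow> real) \<Rightarrow> torus \<Rightarrow> torus"
  where "twist_map g = (\<lambda>(x, y). let y' = to_circle (g x) + y in (x + y', y'))"

text \<open>Since the torus is compact, the torus homeomorphisms are elements of the type of bounded
  continuous functions, whose metric is the supremum distance; hence the subspace topology on
  \<open>D0\<close> is that of uniform convergence.\<close>

definition D0 :: "(torus \<Rightarrow>\<^sub>C torus) set"
  where "D0 = {T. (\<exists>S. homeomorphism UNIV UNIV (apply_bcontfun T) S) \<and>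
    (\<exists>g. zero_mean_lipschitz g \<and> apply_bcontfun T = twist_map g)}"

definition assoc_fun :: "(torus \<Rightarrow>\<^sub>C torus) \<Rightarrow> circle \<Rightarrow> real"
  where "assoc_fun T = (THE g. zero_mean_lipschitz g \<and> apply_bcontfun T = twist_map g)"

definition cylinder_lift :: "(torus \<Rightarrow>\<^sub>C torus) \<Rightarrow> circle \<times> real \<Rightarrow> circle \<times> real"
  where "cylinder_lift T = (\<lambda>(x, y). let y' = assoc_fun T x + y in (x + to_circle y', y'))"

definition rho_V :: "(torus \<Rightarrow>\<^sub>C torus) \<Rightarrow> real set"
  where "rho_V T = {\<omega>. \<exists>X. (\<lambda>n. (snd ((cylinder_lift T ^^ n) X) - snd X) / real n) \<longlonglongrightarrow> \<omega>}"

definition rho_V_max :: "(torus \<Rightarrow>\<^sub>C torus) \<Rightarrow> real"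
  where "rho_V_max T = (GREATEST \<omega>. \<omega> \<in> rho_V T)"

definition rho_V_min :: "(torus \<Rightarrow>\<^sub>C torus) \<Rightarrow> real"
  where "rho_V_min T = (LEAST \<omega>. \<omega> \<in> rho_V T)"

text \<open>The description in \<open>assoc_fun\<close> is well defined on \<open>D0\<close>: two generating functions of the same
  map differ by a continuous integer-valued function, which is constant and has mean zero.\<close>

lemma twist_map_inject:
  assumes "zero_mean_lipschitz g" "zero_mean_lipschitz h" "twist_map g = twist_map h"
  shows "g = h"
proof -
  define G where "G = (\<lambda>t. g (to_circle t))"
  define H where "H = (\<lambda>t. h (to_circle t))"
  have "continuous_on UNIV g" "continuous_on UNIV h"
    using assms(1,2) lipschitz_on_continuous_on unfolding zero_mean_lipschitz_def by blast+
  then have cont: "continuous_on A G" "continuous_on A H" for A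
    unfolding G_def H_def
    by (auto intro: continuous_on_compose2[OF _ continuous_on_to_circle])
  have int: "G t - H t \<in> \<int>" for t
  proof -
    have "twist_map g (to_circle t, 0) = twist_map h (to_circle t, 0)"
      using assms(3) by simp
    then show ?thesis
      by (simp add: twist_map_def Let_def to_circle_eq_iff G_def H_def)
  qed
  have "(\<lambda>t. G t - H t) constant_on UNIV"
  proof (rule continuous_discrete_range_constant)
    show "\<exists>e>0. \<forall>y. y \<in> UNIV \<and> G y - H y \<noteq> G x - H x \<longrightarrow> e \<le> norm ((G y - H y) - (G x - H x))"
      for x
      using Ints_nonzero_abs_ge1[OF Ints_diff[OF int int]]
      by (intro exI[of _ 1]) auto
  qed (auto intro: continuous_on_diff cont)
  then obtain c where c: "\<And>t. G t - H t = c"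
    unfolding constant_on_def by auto
  have "integral {0..1} (\<lambda>t. G t - H t) = integral {0..1} G - integral {0..1} H"
    by (intro integral_diff integrable_continuous_real cont)
  also have "\<dots> = 0"
    using assms(1,2) by (simp add: zero_mean_lipschitz_def G_def H_def)
  finally have "c = 0" by (simp add: c)
  have "g x = h x" for x
    using c \<open>c = 0\<close> by (induct x rule: circle.abs_induct) (simp add: G_def H_def)
  then show ?thesis by blast
qed

lemma assoc_fun_eq:
  "zero_mean_lipschitz g \<Longrightarrow> apply_bcontfun T = twist_map g \<Longrightarrow> assoc_fun T = g"
  unfolding assoc_fun_def by (rule the_equality) (auto intro: twist_map_inject)

end

theory Submission
  imports Defs "HOL-Library.Periodic_Fun"
begin

text \<open>Start from the region below a horizontal circle of the cylinder, take its image, fill in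
  everything below that image, and repeat. By the twist condition the upper boundaries of the
  resulting regions oscillate by at most 1, so they advance at a well-defined speed up to an error
  bounded uniformly in time and in the map; as each finite stage depends continuously on the map, so
  does the speed. A point of a boundary is the image of a point of the preceding boundary (the filling
  creates no new maximal points), so by compactness some orbit advances at exactly this speed, and no
  orbit is faster: the speed is the maximum of the vertical rotation set. The minimum is the
  maximum for the map conjugated by \<open>(x, y) \<mapsto> (-x, -y)\<close>.\<close>

text \<open>Both coordinates are real, unlike in \<open>cylinder_lift\<close>, so that preimages
  over a point can be ordered by abscissa.\<close>

definition lift_map :: "(real \<Rightarrow> real) \<Rightarrow> real \<times> real \<Rightarrow> real \<times> real"
  where "lift_map G = (\<lambda>(x, y). (x + (G x + y), G x + y))"

definition rot_set :: "(real \<Rightarrow> real) \<Rightarrow> real set"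
  where "rot_set G = {\<omega>. \<exists>x y. (\<lambda>n. (snd ((lift_map G ^^ n) (x, y)) - y) / real n) \<longlonglongrightarrow> \<omega>}"

text \<open>Lifts of nondecreasing circle maps of degree one, possibly discontinuous. Periodicity of
  \<open>x - m x\<close> lets the curve close up on the cylinder; monotonicity says that it rises
  with slope at most 1 and jumps only downwards.\<close>

definition degree_one :: "(real \<Rightarrow> real) \<Rightarrow> bool"
  where "degree_one m \<longleftrightarrow> mono m \<and> (\<forall>x. m (x + 1) = m x + 1)"

text \<open>A boundary curve \<open>y = x - m x\<close> is encoded by \<open>m\<close>: as \<open>y' = x' - x\<close> along orbits, the next \<open>m\<close>
  sends \<open>x'\<close> to the abscissa of the preimage of the highest point above \<open>x'\<close>.\<close>

definition next_front :: "(real \<Rightarrow> real) \<Rightarrow> (real \<Rightarrow> real) \<Rightarrow> real \<Rightarrow> real"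
  where "next_front G m x' = Inf {x. x' \<le> 2 * x + G x - m x}"

text \<open>The starting value, the identity, encodes the horizontal circle
  \<open>y = 0\<close>.\<close>

definition front :: "(real \<Rightarrow> real) \<Rightarrow> nat \<Rightarrow> real \<Rightarrow> real"
  where "front G n = (next_front G ^^ n) (\<lambda>x. x)"

definition height :: "(real \<Rightarrow> real) \<Rightarrow> nat \<Rightarrow> real \<Rightarrow> real"
  where "height G n x = x - front G n x"

lemma front_0 [simp]: "front G 0 x = x"
  by (simp add: front_def)

lemma front_Suc: "front G (Suc n) = next_front G (front G n)"
  by (simp add: front_def)

lemma degree_one_mono: "degree_one m \<Longrightarrow> x \<le> y \<Longrightarrow> m x \<le> m y"
  by (auto simp: degree_one_def mono_def)

lemma degree_one_add_int:
  assumes "degree_one m"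
  shows "m (x + of_int k) = m x + of_int k"
proof -
  interpret periodic_fun_simple' "\<lambda>x. m x - x"
    by standard (use assms in \<open>simp add: degree_one_def\<close>)
  show ?thesis using plus_of_int[of x k] by simp
qed

text \<open>As \<open>x - m x\<close> is 1-periodic, \<open>z\<close> can be moved by an integer to
  lie less than 1 behind \<open>x\<close>, where monotonicity compares the values.\<close>

lemma degree_one_osc:
  assumes "degree_one m"
  shows "\<bar>(x - m x) - (z - m z)\<bar> \<le> 1"
proof -
  have *: "(x - m x) - (z - m z) \<le> 1" for x z
  proof -
    have "m (z + of_int \<lfloor>x - z\<rfloor>) \<le> m x"
      by (rule degree_one_mono[OF assms]) linarith
    then show ?thesis
      unfolding degree_one_add_int[OF assms] by linarith
  qed
  show ?thesis using *[of x z] *[of z x] by linarith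
qed

section \<open>Almost additive sequences\<close>

text \<open>A Fekete-type argument: \<open>k * s n\<close> and \<open>n * s k\<close> are both
  compared with \<open>s (k * n)\<close>, so every lower rate \<open>(s n - C) / n\<close> is at
  most every upper rate \<open>(s k + C) / k\<close>. The supremum of the lower rates separates the
  two families.\<close>

lemma almost_additive_imp_almost_linear:
  fixes s :: "nat \<Rightarrow> real"
  assumes add: "\<And>m n. \<bar>s (m + n) - s m - s n\<bar> \<le> C"
  obtains R :: real where "\<And>n. \<bar>s n - n * R\<bar> \<le> C"
proof -
  have C: "C \<ge> 0" and s0: "\<bar>s 0\<bar> \<le> C" using add[of 0 0] by auto
  have mult: "\<bar>s (k * n) - k * s n\<bar> \<le> k * C" if "k > 0" for k n :: nat
    using that
  proof (induction k rule: nat_induct_non_zero)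
    case 1
    then show ?case using C by simp
  next
    case (Suc k)
    have "real (Suc k) * s n = s n + k * s n" "real (Suc k) * C = C + k * C"
      by (simp_all add: distrib_right)
    then show ?case using Suc.IH add[of n "k * n"] by (simp add: abs_le_iff)
  qed
  have le: "(s n - C) / n \<le> (s k + C) / k" if "n > 0" "k > 0" for n k :: nat
  proof -
    have "k * s n - k * C \<le> n * s k + n * C"
      using mult[OF that(1), of k] mult[OF that(2), of n]
      by (simp add: abs_le_iff mult.commute[of k n])
    then show ?thesis using that by (simp add: divide_le_eq le_divide_eq algebra_simps)
  qed
  define R where "R = (SUP n\<in>{0<..}. (s n - C) / real n)"
  have lo: "(s n - C) / n \<le> R" if "n > 0" for n :: nat
    unfolding R_def
  proof (rule cSUP_upper)
    show "bdd_above ((\<lambda>n. (s n - C) / real n) ` {0<..})"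
      using le[of _ 1] by (intro bdd_aboveI2[of _ _ "(s 1 + C) / 1"]) simp
  qed (use that in simp)
  have hi: "R \<le> (s k + C) / k" if "k > 0" for k :: nat
    unfolding R_def by (rule cSUP_least) (use le that in auto)
  have "\<bar>s n - n * R\<bar> \<le> C" for n
  proof (cases "n = 0")
    case False
    then have "s n - C \<le> R * n" "R * n \<le> s n + C"
      using lo[of n] hi[of n] by (simp_all add: divide_le_eq le_divide_eq)
    then show ?thesis by (simp add: abs_le_iff mult.commute)
  qed (use s0 in simp)
  then show ?thesis by (rule that)
qed

section \<open>The front recursion for a periodic function\<close>

locale circle_fun =
  fixes G :: "real \<Rightarrow> real"
  assumes continuous: "continuous_on UNIV G"
    and periodic: "G (x + 1) = G x"
begin

sublocale periodic_fun_simple' G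
  by standard (rule periodic)

lemma bounded_values: obtains B where "\<And>x. \<bar>G x\<bar> \<le> B"
proof -
  have "bounded (G ` {0..1})"
    by (intro compact_imp_bounded compact_continuous_image continuous_on_subset[OF continuous]) auto
  then obtain B where B: "\<forall>x\<in>{0..1}. \<bar>G x\<bar> \<le> B"
    by (auto simp: bounded_iff)
  have "\<bar>G x\<bar> \<le> B" for x
    using bspec[OF B, of "frac x"] plus_of_int[of "frac x" "\<lfloor>x\<rfloor>"] frac_lt_1[of x]
    by (simp add: frac_def)
  then show ?thesis by (rule that)
qed

context
  fixes m assumes m: "degree_one m"
begin

text \<open>The expression \<open>2 * x + G x - m x\<close> stays within bounded distance of
  \<open>x\<close>, since \<open>G\<close> is bounded and \<open>x - m x\<close> oscillates by at
  most 1.\<close>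

lemma next_front_set:
  "{x. x' \<le> 2 * x + G x - m x} \<noteq> {}" "bdd_below {x. x' \<le> 2 * x + G x - m x}"
proof -
  obtain B where B: "\<And>x. \<bar>G x\<bar> \<le> B" using bounded_values by blast
  have h: "\<bar>2 * x + G x - m x - x\<bar> \<le> B + 1 + \<bar>m 0\<bar>" for x
    using B[of x] degree_one_osc[OF m, of x 0] by linarith
  show "{x. x' \<le> 2 * x + G x - m x} \<noteq> {}"
    using h[of "x' + B + 1 + \<bar>m 0\<bar>"] by (auto intro!: exI[of _ "x' + B + 1 + \<bar>m 0\<bar>"])
  show "bdd_below {x. x' \<le> 2 * x + G x - m x}"
  proof (rule bdd_belowI)
    show "x' - (B + 1 + \<bar>m 0\<bar>) \<le> x" if "x \<in> {x. x' \<le> 2 * x + G x - m x}" for x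
      using that h[of x] by auto
  qed
qed

lemma next_front_le: "x' \<le> 2 * x + G x - m x \<Longrightarrow> next_front G m x' \<le> x"
  unfolding next_front_def by (intro cInf_lower next_front_set) auto

text \<open>The highest point above \<open>x'\<close> comes from the old curve itself, not from
  below it: \<open>m\<close> jumps only upwards, so \<open>2 * x + G x - m x\<close> cannot jump up
  past the level \<open>x'\<close>.\<close>

lemma next_front_eq:
  assumes "x = next_front G m x'"
  shows "2 * x + G x - m x = x'"
proof (rule antisym)
  \<comment> \<open>Freezing \<open>m\<close> at \<open>m x\<close> gives a continuous comparison
    function; by monotonicity it lies below the true one to the left of \<open>x\<close> and above
    it to the right.\<close>
  have lim: "((\<lambda>z. 2 * z + G z - m x) \<longlongrightarrow> 2 * x + G x - m x) (at x within S)" for S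
    using continuous by (intro tendsto_intros)
      (auto simp: continuous_on_eq_continuous_within continuous_within intro: tendsto_within_subset)
  show "2 * x + G x - m x \<le> x'"
  proof (rule tendsto_upperbound[OF lim[of "{..<x}"]])
    have "2 * z + G z - m x \<le> x'" if "z < x" for z
      using next_front_le[of x' z] that assms degree_one_mono[OF m, of z x] by force
    then show "\<forall>\<^sub>F z in at_left x. 2 * z + G z - m x \<le> x'"
      by (auto simp: eventually_at_filter)
  qed simp
  show "x' \<le> 2 * x + G x - m x"
  proof (rule ccontr)
    assume gt: "\<not> ?thesis"
    then have "\<forall>\<^sub>F z in at_right x. 2 * z + G z - m x < x'"
      using order_tendstoD(2)[OF lim] by simp
    then obtain b where b: "b > x" "\<And>z. x < z \<Longrightarrow> z < b \<Longrightarrow> 2 * z + G z - m x < x'"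
      by (auto simp: eventually_at_right_field)
    have "b \<le> z" if z: "x' \<le> 2 * z + G z - m z" for z
    proof -
      have "x \<le> z" using next_front_le[OF z] assms by simp
      moreover have "z \<noteq> x" using gt z by auto
      moreover have "\<not> 2 * z + G z - m x < x'"
        using z degree_one_mono[OF m \<open>x \<le> z\<close>] by linarith
      ultimately show ?thesis using b(2)[of z] by force
    qed
    then have "b \<le> next_front G m x'"
      unfolding next_front_def by (intro cInf_greatest next_front_set) auto
    with b(1) assms show False by simp
  qed
qed

lemma degree_one_next_front: "degree_one (next_front G m)"
  unfolding degree_one_def
proof (intro conjI allI)
  show "mono (next_front G m)"
    unfolding mono_def next_front_def
    by (intro allI impI cInf_superset_mono next_front_set) auto
  have m1: "m (x + 1) = m x + 1" "m (x - 1) = m x - 1" for x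
    using degree_one_add_int[OF m, of x 1] degree_one_add_int[OF m, of x "-1"] by auto
  show "next_front G m (x + 1) = next_front G m x + 1" for x
  proof (rule antisym)
    show "next_front G m (x + 1) \<le> next_front G m x + 1"
      using next_front_eq[OF refl, of x] by (intro next_front_le) (simp add: m1 plus_1)
    have "next_front G m x \<le> next_front G m (x + 1) - 1"
      using next_front_eq[OF refl, of "x + 1"] by (intro next_front_le) (simp add: m1 minus_1)
    then show "next_front G m x + 1 \<le> next_front G m (x + 1)" by simp
  qed
qed

end

lemma degree_one_front: "degree_one (front G n)"
proof (induction n)
  case 0
  then show ?case by (simp add: front_def degree_one_def mono_def)
qed (simp add: front_Suc degree_one_next_front)

text \<open>Larger \<open>m\<close> means a lower curve. An integer vertical shift moves abscissas
  by an integer, which \<open>G\<close> does not see, so the old preimage translated by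
  \<open>k\<close> is a candidate in the infimum for \<open>m'\<close>.\<close>

lemma next_front_shift:
  assumes m: "degree_one m" and m': "degree_one m'"
    and le: "\<And>x. m' x \<le> m x + of_int k"
  shows "next_front G m' x \<le> next_front G m x + of_int k"
proof -
  let ?z = "next_front G m x"
  have "x \<le> 2 * (?z + k) + G (?z + k) - m' (?z + k)"
    using next_front_eq[OF m refl, of x] le[of "?z + k"]
    by (simp add: degree_one_add_int[OF m] plus_of_int)
  then show ?thesis by (rule next_front_le[OF m'])
qed

lemma degree_one_iterate:
  "degree_one m \<Longrightarrow> degree_one ((next_front G ^^ n) m)"
  by (induction n) (auto intro: degree_one_next_front)

lemma iterate_shift:
  assumes "degree_one m" "degree_one m'" "\<And>x. m' x \<le> m x + of_int k"
  shows "(next_front G ^^ n) m' x \<le> (next_front G ^^ n) m x + of_int k"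
  by (induction n arbitrary: x)
     (auto intro!: next_front_shift assms(3) degree_one_iterate[OF assms(1)] degree_one_iterate[OF assms(2)])

lemma height_osc: "\<bar>height G n x - height G n z\<bar> \<le> 1"
  unfolding height_def by (rule degree_one_osc[OF degree_one_front])

text \<open>After \<open>k\<close> steps the front is enclosed between two horizontal lines of
  integer height; \<open>n\<close> further steps from either line reproduce the front at time
  \<open>n\<close>, shifted by that integer.\<close>

lemma height_almost_additive:
  "\<bar>height G (n + k) 0 - height G n 0 - height G k 0\<bar> \<le> 2"
proof -
  define j where "j = \<lfloor>height G k 0\<rfloor>"
  have j: "j \<le> height G k 0" "height G k 0 < j + 1" by (auto simp: j_def)
  have eq: "front G (n + k) = (next_front G ^^ n) (front G k)"
    by (simp add: front_def funpow_add)
  have id: "degree_one (\<lambda>x. x)" using degree_one_front[of 0] by (simp add: front_def)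
  \<comment> \<open>The height at 0 lies in \<open>[j, j + 1)\<close> and the oscillation is at most
    1, so all heights lie between \<open>j - 1\<close> and \<open>j + 2\<close>.\<close>
  have fk: "front G k x \<le> x + of_int (1 - j)" "x \<le> front G k x + of_int (j + 2)" for x
    using j height_osc[of k x 0] by (auto simp: height_def)
  have "front G (n + k) 0 \<le> front G n 0 + of_int (1 - j)"
    unfolding eq unfolding front_def[of G n] by (rule iterate_shift[OF id degree_one_front fk(1)])
  moreover have "front G n 0 \<le> front G (n + k) 0 + of_int (j + 2)"
    unfolding eq unfolding front_def[of G n] by (rule iterate_shift[OF degree_one_front id fk(2)])
  ultimately show ?thesis using j by (simp add: height_def)
qed

text \<open>The abscissa before a step is itself a candidate in the infimum defining the next front;
  the integer \<open>k\<close> passes from heights to abscissas by equivariance.\<close>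

lemma below_front:
  assumes "y \<le> of_int k"
  shows "snd ((lift_map G ^^ n) (x, y)) \<le> height G n (fst ((lift_map G ^^ n) (x, y))) + of_int k"
proof (induction n)
  case 0
  then show ?case using assms by (simp add: height_def)
next
  case (Suc n)
  obtain u v where uv: "(lift_map G ^^ n) (x, y) = (u, v)" by fastforce
  then have v: "v \<le> u - front G n u + k" using Suc by (simp add: height_def)
  have "next_front G (front G n) (u + (G u + v) - k) \<le> u"
    using v by (intro next_front_le degree_one_front) auto
  moreover have "front G (Suc n) (u + (G u + v)) =
      front G (Suc n) (u + (G u + v) - k) + k"
    using degree_one_add_int[OF degree_one_front, of "Suc n" "u + (G u + v) - k" k] by simp
  moreover have "(lift_map G ^^ Suc n) (x, y) = (u + (G u + v), G u + v)"
    by (simp add: uv) (simp add: lift_map_def)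
  ultimately show ?case
    by (simp add: height_def front_Suc del: funpow.simps)
qed

text \<open>The orbit is built backwards: by \<open>next_front_eq\<close> a point of a front has a
  preimage on the preceding front. Since \<open>x0\<close> depends on \<open>n\<close>, an infinite
  orbit requires compactness.\<close>

lemma orbit_on_fronts:
  "\<exists>x0. (lift_map G ^^ n) (x0, 0) = (x, height G n x) \<and>
    (\<forall>k\<le>n. \<exists>z. (lift_map G ^^ k) (x0, 0) = (z, height G k z))"
proof (induction n arbitrary: x)
  case 0
  then show ?case by (auto simp: height_def)
next
  case (Suc n)
  define z where "z = front G (Suc n) x"
  have z: "2 * z + G z - front G n z = x"
    by (rule next_front_eq[OF degree_one_front]) (simp add: z_def front_Suc)
  obtain x0 where x0: "(lift_map G ^^ n) (x0, 0) = (z, height G n z)"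
    "\<forall>k\<le>n. \<exists>z. (lift_map G ^^ k) (x0, 0) = (z, height G k z)"
    using Suc by blast
  have *: "(lift_map G ^^ Suc n) (x0, 0) = (x, height G (Suc n) x)"
    using x0(1) z by (simp add: lift_map_def height_def flip: z_def)
  show ?case
    using * x0(2) le_Suc_eq by metis
qed

lemma lift_map_translate:
  "snd ((lift_map G ^^ n) (x + of_int k, y)) = snd ((lift_map G ^^ n) (x, y))"
proof -
  have "(lift_map G ^^ n) (x + of_int k, y) = (lift_map G ^^ n) (x, y) + (of_int k, 0)"
    by (induction n) (auto simp: lift_map_def plus_of_int split: prod.splits)
  then show ?thesis by simp
qed

lemma continuous_lift_map: "continuous_on UNIV (lift_map G ^^ n)"
proof (induction n)
  case (Suc n)
  have "continuous_on UNIV (lift_map G)"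
    unfolding lift_map_def case_prod_beta
    by (intro continuous_intros continuous_on_compose2[OF continuous]) auto
  then show ?case
    unfolding funpow.simps by (intro continuous_on_compose Suc) (auto intro: continuous_on_subset)
qed (simp add: continuous_on_id id_def)

section \<open>The speed as maximum of the rotation set\<close>

lemma ex_speed:
  obtains R :: real where "\<And>n x. \<bar>height G n x - n * R\<bar> \<le> 3"
    "R \<in> rot_set G" "\<And>\<omega>. \<omega> \<in> rot_set G \<Longrightarrow> \<omega> \<le> R"
proof -
  obtain R :: real where R: "\<And>n. \<bar>height G n 0 - n * R\<bar> \<le> 2"
    using almost_additive_imp_almost_linear[of "\<lambda>n. height G n 0" 2] height_almost_additive by blast
  \<comment> \<open>The bound 3 is 2 from almost additivity plus 1 for the oscillation between
    \<open>x\<close> and 0.\<close>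
  have h: "\<bar>height G n x - n * R\<bar> \<le> 3" for n x
    using R[of n] height_osc[of n x 0] by linarith
  have lim3: "(\<lambda>n. c / real n) \<longlonglongrightarrow> 0" for c
    by (rule lim_const_over_n)
  \<comment> \<open>Starting abscissas that keep pace with \<open>R\<close> up to time
    \<open>n\<close>: nested compact sets, nonempty by orbits on fronts. A common point keeps pace
    forever.\<close>
  define K where "K = (\<lambda>n. {x\<in>{0..1}. \<forall>k\<le>n. \<bar>snd ((lift_map G ^^ k) (x, 0)) - k * R\<bar> \<le> 3})"
  have "\<Inter>(range K) \<noteq> {}"
  proof (rule compact_nest)
    fix n
    have "K n = {0..1} \<inter> (\<Inter>k\<le>n. {x. \<bar>snd ((lift_map G ^^ k) (x, 0)) - k * R\<bar> \<le> 3})"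
      by (auto simp: K_def)
    moreover have "closed {x. \<bar>snd ((lift_map G ^^ k) (x, 0)) - k * R\<bar> \<le> 3}" for k
      by (intro closed_Collect_le continuous_intros continuous_on_compose2[OF continuous_lift_map]) auto
    ultimately show "compact (K n)"
      by (auto intro!: compact_Int_closed)
    obtain x0 where x0: "\<forall>k\<le>n. \<exists>z. (lift_map G ^^ k) (x0, 0) = (z, height G k z)"
      using orbit_on_fronts by blast
    have "snd ((lift_map G ^^ k) (frac x0, 0)) = snd ((lift_map G ^^ k) (x0, 0))" for k
      using lift_map_translate[of k "frac x0" "\<lfloor>x0\<rfloor>" 0] by (simp add: frac_def)
    then have "frac x0 \<in> K n"
      using x0 h frac_lt_1[of x0] by (force simp: K_def)
    then show "K n \<noteq> {}" by blast
  qed (auto simp: K_def)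
  then obtain x where x: "\<And>n. \<bar>snd ((lift_map G ^^ n) (x, 0)) - n * R\<bar> \<le> 3"
    unfolding K_def by force
  have "(\<lambda>n. (snd ((lift_map G ^^ n) (x, 0)) - n * R) / n) \<longlonglongrightarrow> 0"
    by (rule tendsto_rabs_zero_cancel, rule tendsto_sandwich[OF _ _ tendsto_const lim3[of 3]])
       (use x in \<open>auto intro!: always_eventually divide_right_mono\<close>)
  then have "(\<lambda>n. (snd ((lift_map G ^^ n) (x, 0)) - n * R) / n + R) \<longlonglongrightarrow> 0 + R"
    by (intro tendsto_intros)
  then have "(\<lambda>n. (snd ((lift_map G ^^ n) (x, 0)) - n * R) / n + R) \<longlonglongrightarrow> R"
    by simp
  then have "(\<lambda>n. snd ((lift_map G ^^ n) (x, 0)) / n) \<longlonglongrightarrow> R"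
    by (rule Lim_transform_eventually)
       (auto intro!: eventually_mono[OF eventually_gt_at_top[of 0]] simp: field_simps)
  then have "R \<in> rot_set G"
    unfolding rot_set_def by (intro CollectI exI[of _ x] exI[of _ "0::real"]) simp
  moreover have "\<omega> \<le> R" if \<omega>: "\<omega> \<in> rot_set G" for \<omega>
  proof -
    obtain x y where xy: "(\<lambda>n. (snd ((lift_map G ^^ n) (x, y)) - y) / real n) \<longlonglongrightarrow> \<omega>"
      using \<omega> by (auto simp: rot_set_def)
    \<comment> \<open>The orbit stays below the fronts raised by \<open>\<lceil>y\<rceil>\<close>,
      whose heights differ from \<open>n * R + \<lceil>y\<rceil>\<close> by at most 3.\<close>
    define c where "c = 3 + of_int \<lceil>y\<rceil> - y"
    have up: "snd ((lift_map G ^^ n) (x, y)) - y \<le> n * R + c" for n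
      using below_front[of y "\<lceil>y\<rceil>" n x] h[of n "fst ((lift_map G ^^ n) (x, y))"]
      by (simp add: c_def)
    have "\<forall>\<^sub>F n in sequentially. (snd ((lift_map G ^^ n) (x, y)) - y) / real n \<le> R + c / n"
    proof (intro eventually_mono[OF eventually_gt_at_top[of 0]])
      fix n :: nat assume "n > 0"
      then have "R + c / n = (n * R + c) / n" by (simp add: field_simps)
      then show "(snd ((lift_map G ^^ n) (x, y)) - y) / real n \<le> R + c / n"
        using up[of n] by (simp add: divide_right_mono)
    qed
    moreover have "(\<lambda>n. R + c / n) \<longlonglongrightarrow> R + 0"
      by (intro tendsto_intros lim3)
    ultimately show ?thesis
      using tendsto_le[OF sequentially_bot _ xy] by force
  qed
  ultimately show ?thesis using h that by blast
qed

definition speed :: real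
  where "speed = (GREATEST \<omega>. \<omega> \<in> rot_set G)"

lemma
  shows height_speed: "\<bar>height G n x - n * speed\<bar> \<le> 3"
    and speed_mem: "speed \<in> rot_set G"
    and speed_upper: "\<omega> \<in> rot_set G \<Longrightarrow> \<omega> \<le> speed"
proof -
  obtain R :: real where R: "\<And>n x. \<bar>height G n x - n * R\<bar> \<le> 3"
    "R \<in> rot_set G" "\<And>\<omega>. \<omega> \<in> rot_set G \<Longrightarrow> \<omega> \<le> R"
    using ex_speed by blast
  moreover from R have "speed = R"
    unfolding speed_def by (intro Greatest_equality) auto
  ultimately show "\<bar>height G n x - n * speed\<bar> \<le> 3" "speed \<in> rot_set G"
    "\<omega> \<in> rot_set G \<Longrightarrow> \<omega> \<le> speed" by auto
qed

lemma circle_fun_reflect: "circle_fun (\<lambda>x. - G (- x))"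
proof
  show "continuous_on UNIV (\<lambda>x. - G (- x))"
    by (intro continuous_intros continuous_on_compose2[OF continuous]) auto
  show "- G (- (x + 1)) = - G (- x)" for x
    using minus_1[of "-x"] by (simp add: minus_diff_commute)
qed

end

section \<open>Continuous dependence of the speed\<close>

text \<open>Fronts have jumps, so those of nearby functions are close only up to a horizontal shift.\<close>

lemma front_perturb:
  assumes "circle_fun G" "circle_fun G'" "L \<ge> 0" "d \<ge> 0"
    and le: "\<And>x a. a \<ge> 0 \<Longrightarrow> G x - L * a - d \<le> G' (x - a)"
  shows "front G' n x \<le> front G n (x + d * (3 + L) ^ n)"
proof -
  interpret G: circle_fun G by fact
  interpret G': circle_fun G' by fact
  show ?thesis
  proof (induction n arbitrary: x)
    case 0
    then show ?case using assms by simp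
  next
    case (Suc n)
    define a where "a = d * (3 + L) ^ n"
    have a: "d \<le> a" 
      using assms(3,4) unfolding a_def by (simp add: mult_le_cancel_left1)
    define w where "w = x + d * (3 + L) ^ Suc n"
    \<comment> \<open>Moving left by \<open>a\<close> costs \<open>2 * a\<close> in the term
      \<open>2 * x\<close> and \<open>L * a + d\<close> in passing from \<open>G\<close> to
      \<open>G'\<close>; as \<open>d \<le> a\<close>, the factor \<open>3 + L\<close> pays for all
      of it.\<close>
    have w: "x + 2 * a + L * a + d \<le> w"
      using a by (simp add: w_def algebra_simps flip: a_def) (simp add: a_def algebra_simps)
    \<comment> \<open>The preimage \<open>z\<close> for \<open>G\<close>, moved left by
      \<open>a\<close>, is the candidate in the infimum for \<open>G'\<close>.\<close>
    define z where "z = next_front G (front G n) w"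
    have z: "2 * z + G z - front G n z = w"
      by (rule G.next_front_eq[OF G.degree_one_front z_def])
    have "front G' n (z - a) \<le> front G n z"
      using Suc[of "z - a"] by (simp add: a_def)
    then have "next_front G' (front G' n) x \<le> z - a"
      using z w le[of a z] a assms(4)
      by (intro G'.next_front_le G'.degree_one_front) (simp add: algebra_simps)
    then show ?case using a assms(4) by (simp add: front_Suc z_def w_def)
  qed
qed

text \<open>The 6 is twice the error 3 of approximating heights by \<open>n * speed\<close>; the
  horizontal displacement between the fronts adds to the height.\<close>

lemma speed_perturb:
  assumes G: "circle_fun G" and G': "circle_fun G'" "L \<ge> 0" "d \<ge> 0"
    and "\<And>x a. a \<ge> 0 \<Longrightarrow> G x - L * a - d \<le> G' (x - a)"
  shows "n * circle_fun.speed G \<le> n * circle_fun.speed G' + 6 + d * (3 + L) ^ n"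
  using front_perturb[OF assms, of n 0] circle_fun.height_speed[OF G, of n "0 + d * (3 + L) ^ n"]
    circle_fun.height_speed[OF G'(1), of n 0]
  by (simp add: height_def)

lemma speed_continuous:
  assumes G: "circle_fun G" and L: "L-lipschitz_on UNIV G" and "e > 0"
  obtains \<delta> where "\<delta> > 0"
    "\<And>G'. circle_fun G' \<Longrightarrow> (\<And>x. \<bar>G x - G' x\<bar> \<le> \<delta>) \<Longrightarrow>
      \<bar>circle_fun.speed G - circle_fun.speed G'\<bar> < e"
proof -
  have L0: "L \<ge> 0" using L by (rule lipschitz_on_nonneg)
  \<comment> \<open>The time \<open>n\<close> is fixed first, then \<delta> is chosen to make the
    accumulated shift 1; the total error 6 + 1 is below \<open>n * e\<close>. The Lipschitz constant
    of \<open>G\<close> serves both directions, so \<delta> does not depend on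
    \<open>G'\<close>.\<close>
  obtain n :: nat where n: "n > 7 / e" using reals_Archimedean2 by blast
  with \<open>e > 0\<close> have "0 < 7 / e" by simp
  with n have n0: "n > 0" by (metis gr0I of_nat_0 order.asym)
  define \<delta> where "\<delta> = 1 / (3 + L) ^ n"
  have \<delta>: "\<delta> > 0" "\<delta> * (3 + L) ^ n = 1" using L0 by (auto simp: \<delta>_def)
  show ?thesis
  proof (rule that[OF \<delta>(1)])
    fix G' assume G': "circle_fun G'" and le: "\<And>x. \<bar>G x - G' x\<bar> \<le> \<delta>"
    have Lip: "\<bar>G x - G (x - a)\<bar> \<le> L * a" if "a \<ge> 0" for x a
      using lipschitz_onD[OF L, of x "x - a"] that by (simp add: dist_real_def)
    have "G x - L * a - \<delta> \<le> G' (x - a)" "G' x - L * a - \<delta> \<le> G (x - a)" if "a \<ge> 0" for x a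
      using Lip[OF that, of x] le[of "x - a"] le[of x] by linarith+
    then have "n * \<bar>circle_fun.speed G - circle_fun.speed G'\<bar> \<le> 7"
      using speed_perturb[OF G G' L0, of \<delta> n] speed_perturb[OF G' G L0, of \<delta> n] \<delta>
      by (auto simp: abs_if algebra_simps)
    also have "7 < n * e" using n \<open>e > 0\<close> by (simp add: field_simps)
    finally show "\<bar>circle_fun.speed G - circle_fun.speed G'\<bar> < e"
      using n0 by simp
  qed
qed

section \<open>Reflection and the minimum\<close>

lemma rot_set_reflect: "\<omega> \<in> rot_set (\<lambda>x. - G (- x)) \<longleftrightarrow> - \<omega> \<in> rot_set G"
proof -
  have it: "(lift_map (\<lambda>x. - G (- x)) ^^ n) (x, y) = - (lift_map G ^^ n) (- x, - y)" for n x y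
    by (induction n) (auto simp: lift_map_def split: prod.splits)
  have eq: "(\<lambda>n. (snd ((lift_map (\<lambda>x. - G (- x)) ^^ n) (x, y)) - y) / real n) \<longlonglongrightarrow> \<omega> \<longleftrightarrow>
    (\<lambda>n. (snd ((lift_map G ^^ n) (- x, - y)) - (- y)) / real n) \<longlonglongrightarrow> - \<omega>" for x y
    unfolding it by (subst tendsto_minus_cancel_left) (simp add: minus_divide_left)
  have "(\<exists>x y. P (- x) (- y)) \<longleftrightarrow> (\<exists>x y. P x y)" for P :: "real \<Rightarrow> real \<Rightarrow> bool"
    by (metis minus_minus)
  from this[of "\<lambda>x y. (\<lambda>n. (snd ((lift_map G ^^ n) (x, y)) - y) / real n) \<longlonglongrightarrow> - \<omega>"]
  show ?thesis
    unfolding rot_set_def mem_Collect_eq eq .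
qed

context circle_fun
begin

lemma Least_rot_set:
  "(LEAST \<omega>. \<omega> \<in> rot_set G) = - circle_fun.speed (\<lambda>x. - G (- x))"
proof -
  interpret r: circle_fun "\<lambda>x. - G (- x)" by (rule circle_fun_reflect)
  show ?thesis
  proof (rule Least_equality)
    show "- r.speed \<in> rot_set G"
      using r.speed_mem by (simp add: rot_set_reflect)
    show "- r.speed \<le> \<omega>" if "\<omega> \<in> rot_set G" for \<omega>
      using r.speed_upper[of "- \<omega>"] that by (simp add: rot_set_reflect)
  qed
qed

end

section \<open>From torus maps to periodic functions\<close>

definition lift_fun :: "(torus \<Rightarrow>\<^sub>C torus) \<Rightarrow> real \<Rightarrow> real"
  where "lift_fun T t = assoc_fun T (to_circle t)"

text \<open>The surjection \<open>map_prod to_circle id\<close> semiconjugates the planar lift to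
  the cylinder lift and keeps heights.\<close>

lemma rho_V_eq: "rho_V T = rot_set (lift_fun T)"
proof -
  have it: "(cylinder_lift T ^^ n) (to_circle x, y) =
    map_prod to_circle id ((lift_map (lift_fun T) ^^ n) (x, y))" for n x y
    by (induction n)
       (auto simp: lift_map_def cylinder_lift_def lift_fun_def Let_def to_circle_add split: prod.splits)
  have surj: "\<exists>x. c = to_circle x" for c
    by (induction c rule: circle.abs_induct) auto
  then have ex: "(\<exists>X. P X) \<longleftrightarrow> (\<exists>x y. P (to_circle x, y))" for P :: "circle \<times> real \<Rightarrow> bool"
    by (metis surj old.prod.exhaust)
  show ?thesis
    unfolding rho_V_def rot_set_def ex by (simp add: it)
qed

lemma D0_D:
  assumes "T \<in> D0"
  shows "zero_mean_lipschitz (assoc_fun T)" "apply_bcontfun T = twist_map (assoc_fun T)"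
proof -
  obtain g where "zero_mean_lipschitz g" "apply_bcontfun T = twist_map g"
    using assms unfolding D0_def by blast
  then show "zero_mean_lipschitz (assoc_fun T)" "apply_bcontfun T = twist_map (assoc_fun T)"
    using assoc_fun_eq[of g T] by simp_all
qed

lemma lift_fun_lipschitz:
  assumes "T \<in> D0"
  obtains L where "L-lipschitz_on UNIV (lift_fun T)"
proof -
  obtain L where L: "L-lipschitz_on UNIV (assoc_fun T)"
    using D0_D(1)[OF assms] by (auto simp: zero_mean_lipschitz_def)
  have "L-lipschitz_on UNIV (lift_fun T)"
  proof (rule lipschitz_onI)
    show "dist (lift_fun T x) (lift_fun T y) \<le> L * dist x y" for x y
    proof -
      have "dist (lift_fun T x) (lift_fun T y) \<le> L * dist (to_circle x) (to_circle y)"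
        unfolding lift_fun_def by (rule lipschitz_onD[OF L]) auto
      also have "\<dots> \<le> L * dist x y"
        using lipschitz_on_nonneg[OF L] dist_to_circle_le[of x y]
        by (intro mult_left_mono) (auto simp: dist_real_def)
      finally show ?thesis .
    qed
  qed (rule lipschitz_on_nonneg[OF L])
  then show ?thesis by (rule that)
qed

lemma circle_fun_lift_fun:
  assumes "T \<in> D0"
  shows "circle_fun (lift_fun T)"
proof
  show "continuous_on UNIV (lift_fun T)"
    using lift_fun_lipschitz[OF assms] lipschitz_on_continuous_on by blast
  have "to_circle (x + 1) = to_circle x" for x
    by (simp add: to_circle_eq_iff)
  then show "lift_fun T (x + 1) = lift_fun T x" for x
    by (simp add: lift_fun_def)
qed

lemma dist_to_circle_small:
  assumes "\<bar>x - y\<bar> \<le> 1 / 2"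
  shows "dist (to_circle x) (to_circle y) = \<bar>x - y\<bar>"
proof (rule antisym[OF dist_to_circle_le])
  have "\<bar>x - y\<bar> \<le> \<bar>(x - y) - of_int k\<bar>" for k :: int
  proof (cases "k = 0")
    case False
    then have "1 \<le> \<bar>of_int k :: real\<bar>" by linarith
    then show ?thesis using assms by linarith
  qed simp
  then show "\<bar>x - y\<bar> \<le> dist (to_circle x) (to_circle y)"
    by (simp add: dist_circle.abs_eq)
qed

text \<open>Closeness on the torus controls the functions only modulo 1; zero mean excludes an
  integer offset. The difference has a zero, and its absolute value cannot reach \<delta>: up to 1/2
  it equals the circle distance, which is below \<delta>.\<close>

lemma lift_fun_close:
  assumes T: "T \<in> D0" and T': "T' \<in> D0" and \<delta>: "\<delta> \<le> 1 / 2" and d: "dist T T' < \<delta>"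
  shows "\<bar>lift_fun T t - lift_fun T' t\<bar> \<le> \<delta>"
proof -
  interpret T: circle_fun "lift_fun T" by (rule circle_fun_lift_fun[OF T])
  interpret T': circle_fun "lift_fun T'" by (rule circle_fun_lift_fun[OF T'])
  define D where "D = (\<lambda>t. lift_fun T t - lift_fun T' t)"
  have contD: "continuous_on A D" for A
    unfolding D_def
    by (intro continuous_on_diff continuous_on_subset[OF T.continuous] continuous_on_subset[OF T'.continuous]) auto
  have close: "dist (to_circle (lift_fun T t)) (to_circle (lift_fun T' t)) < \<delta>" for t
  proof -
    have "dist (to_circle (lift_fun T t)) (to_circle (lift_fun T' t)) \<le>
        dist (apply_bcontfun T (to_circle t, 0)) (apply_bcontfun T' (to_circle t, 0))"
      unfolding D0_D(2)[OF T] D0_D(2)[OF T']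
      using dist_snd_le[of "twist_map (assoc_fun T) (to_circle t, 0)" "twist_map (assoc_fun T') (to_circle t, 0)"]
      by (simp add: twist_map_def Let_def lift_fun_def)
    also have "\<dots> \<le> dist T T'" by (rule dist_bounded)
    finally show ?thesis using d by simp
  qed
  have "integral {0..1} D = integral {0..1} (lift_fun T) - integral {0..1} (lift_fun T')"
    unfolding D_def
    by (intro integral_diff integrable_continuous_real continuous_on_subset[OF T.continuous]
        continuous_on_subset[OF T'.continuous]) auto
  also have "\<dots> = 0"
    using D0_D(1)[OF T] D0_D(1)[OF T'] by (simp add: zero_mean_lipschitz_def lift_fun_def[abs_def])
  finally have int0: "integral {0..1} D = 0" .
  have deriv: "((\<lambda>u. integral {0..u} D) has_real_derivative D t) (at t within {0..1})"
    if "t \<in> {0..1}" for t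
    by (rule integral_has_real_derivative[OF contD that])
  \<comment> \<open>The mean value theorem is applied to the antiderivative of \<open>D\<close>,
    which vanishes at 0 and at 1.\<close>
  obtain t0 where t0: "D t0 = 0"
  proof (rule mvt[of 0 1 "\<lambda>u. integral {0..u} D" "\<lambda>t. (*) (D t)"])
    show "continuous_on {0..1} (\<lambda>u. integral {0..u} D)"
      using deriv by (rule DERIV_continuous_on)
    show "((\<lambda>u. integral {0..u} D) has_derivative (*) (D t)) (at t)" if "0 < t" "t < 1" for t
      using deriv[of t] that by (simp add: at_within_Icc_at has_field_derivative_def)
  qed (use int0 in auto)
  show ?thesis
  proof (rule ccontr)
    assume "\<not> ?thesis"
    then have *: "\<delta> \<le> \<bar>D t\<bar>" by (simp add: D_def)
    have "0 < \<delta>" using d zero_le_dist[of T T'] by linarith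
    moreover have "connected (range (\<lambda>t. \<bar>D t\<bar>))"
      by (intro connected_continuous_image continuous_intros contD) simp
    moreover have "0 \<in> range (\<lambda>t. \<bar>D t\<bar>)" using t0 by (metis abs_zero rangeI)
    ultimately have "\<delta> \<in> range (\<lambda>t. \<bar>D t\<bar>)"
      using * connectedD_interval[of "range (\<lambda>t. \<bar>D t\<bar>)" 0 "\<bar>D t\<bar>" \<delta>] by simp
    then obtain s where "\<bar>D s\<bar> = \<delta>" by auto
    then have "dist (to_circle (lift_fun T s)) (to_circle (lift_fun T' s)) = \<delta>"
      using \<delta> dist_to_circle_small by (simp add: D_def)
    with close[of s] show False by simp
  qed
qed

section \<open>Continuity on the space of twist maps\<close>

lemma rho_V_max_eq:
  assumes "T \<in> D0"
  shows "rho_V_max T = circle_fun.speed (lift_fun T)"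
  using circle_fun.speed_def[OF circle_fun_lift_fun[OF assms]] by (simp add: rho_V_max_def rho_V_eq)

lemma rho_V_min_eq:
  assumes "T \<in> D0"
  shows "rho_V_min T = - circle_fun.speed (\<lambda>x. - lift_fun T (- x))"
  using circle_fun.Least_rot_set[OF circle_fun_lift_fun[OF assms]] by (simp add: rho_V_min_def rho_V_eq)

text \<open>Serves both \<open>lift_fun T\<close> and its reflection: \<open>eq\<close> transfers
  uniform bounds on differences of lifts to \<Phi>.\<close>

lemma continuous_on_speed:
  assumes circle: "\<And>T. T \<in> D0 \<Longrightarrow> circle_fun (\<Phi> T)"
    and Lipschitz: "\<And>T. T \<in> D0 \<Longrightarrow> \<exists>L. L-lipschitz_on UNIV (\<Phi> T)"
    and eq: "\<And>T T' x. \<exists>t. \<bar>\<Phi> T x - \<Phi> T' x\<bar> = \<bar>lift_fun T t - lift_fun T' t\<bar>"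
  shows "continuous_on D0 (\<lambda>T. circle_fun.speed (\<Phi> T))"
  unfolding continuous_on_iff
proof (intro ballI allI impI)
  fix T and e :: real assume T: "T \<in> D0" and e: "e > 0"
  obtain L where L: "L-lipschitz_on UNIV (\<Phi> T)" using Lipschitz[OF T] by blast
  obtain \<delta> where \<delta>: "\<delta> > 0" "\<And>G'. circle_fun G' \<Longrightarrow> (\<And>x. \<bar>\<Phi> T x - G' x\<bar> \<le> \<delta>) \<Longrightarrow>
    \<bar>circle_fun.speed (\<Phi> T) - circle_fun.speed G'\<bar> < e"
    using speed_continuous[OF circle[OF T] L e] by blast
  have "dist (circle_fun.speed (\<Phi> T')) (circle_fun.speed (\<Phi> T)) < e"
    if T': "T' \<in> D0" and d: "dist T' T < min \<delta> (1 / 2)" for T'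
  proof -
    have d': "dist T T' < min \<delta> (1 / 2)" using d by (simp only: dist_commute)
    have "\<bar>lift_fun T t - lift_fun T' t\<bar> \<le> min \<delta> (1 / 2)" for t
      by (rule lift_fun_close[OF T T' min.cobounded2 d'])
    then have "\<bar>\<Phi> T x - \<Phi> T' x\<bar> \<le> \<delta>" for x
      using eq[of T x T'] by (metis min.boundedE)
    then show ?thesis
      using \<delta>(2)[OF circle[OF T']] by (simp add: dist_real_def abs_minus_commute)
  qed
  then show "\<exists>d>0. \<forall>T'\<in>D0. dist T' T < d \<longrightarrow>
      dist (circle_fun.speed (\<Phi> T')) (circle_fun.speed (\<Phi> T)) < e"
    using \<delta>(1) by (intro exI[of _ "min \<delta> (1 / 2)"]) auto
qed

theorem theorem4:
  shows "continuous_on D0 rho_V_max \<and> continuous_on D0 rho_V_min"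
proof
  have "continuous_on D0 (\<lambda>T. circle_fun.speed (lift_fun T))"
    by (rule continuous_on_speed) (auto intro: circle_fun_lift_fun elim: lift_fun_lipschitz)
  then show "continuous_on D0 rho_V_max"
    using rho_V_max_eq by (simp cong: continuous_on_cong)
  have "continuous_on D0 (\<lambda>T. circle_fun.speed (\<lambda>x. - lift_fun T (- x)))"
  proof (rule continuous_on_speed)
    fix T assume T: "T \<in> D0"
    show "circle_fun (\<lambda>x. - lift_fun T (- x))"
      by (rule circle_fun.circle_fun_reflect[OF circle_fun_lift_fun[OF T]])
    obtain L where "L-lipschitz_on UNIV (lift_fun T)" by (rule lift_fun_lipschitz[OF T])
    then have "L-lipschitz_on UNIV (\<lambda>x. - lift_fun T (- x))"
      by (auto simp: lipschitz_on_def dist_minus) (metis dist_minus)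
    then show "\<exists>L. L-lipschitz_on UNIV (\<lambda>x. - lift_fun T (- x))" by blast
  next
    show "\<exists>t. \<bar>- lift_fun T (- x) - - lift_fun T' (- x)\<bar> = \<bar>lift_fun T t - lift_fun T' t\<bar>" for T T' x
      by (rule exI[of _ "- x"]) simp
  qed
  then show "continuous_on D0 rho_V_min"
    using rho_V_min_eq by (simp add: continuous_on_minus cong: continuous_on_cong)
qed

end
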